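(* Suppose $\delta\leq\kappa$ and $V\subseteq\overline{V}$ (transitive class models of ZFC) satisfies the $\delta$ approximation property. If $\nu$ is a $\kappa$-complete filter in $\overline{V}$ on a set $D\in V$, and $\nu$ measures every subset of $D$ lying in $V$ (i.e., for every $X\subseteq D$ with $X\in V$, either $X\in\nu$ or $D\setminus X\in\nu$), then $\nu\cap V\in V$. That is, $\nu$ extends a measure in $V$.
   Context: A pair of transitive classes $M\subseteq N$ satisfies the $\delta$ approximation property if whenever $A\subseteq M$ is a set in $N$ and $A\cap a\in M$ for every $a\in M$ of size less than $\delta$ in $M$, then $A\in M$. *)

theory Defs
  imports Main
begin

text \<open>
  The objects of the ambient universe are the elements of a type \<open>'a\<close> carrying a membership
  relation; classes are HOL sets of such objects. Nothing is assumed about the membership relation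
  itself: all set theory comes from the axioms satisfied by the classes under consideration.
\<close>

class membership =
  fixes mem :: "'a \<Rightarrow> 'a \<Rightarrow> bool"  (infix "\<^bold>\<in>" 50)

definition transitive_class :: "'a::membership set \<Rightarrow> bool" where
  "transitive_class M \<longleftrightarrow> (\<forall>x\<in>M. \<forall>y. y \<^bold>\<in> x \<longrightarrow> y \<in> M)"


text \<open>
  First-order formulas in the language of set theory, with named variables \<open>0, 1, 2, \<dots>\<close>, and
  Tarskian satisfaction in the structure \<open>(M, \<^bold>\<in>)\<close>. They are needed for the two axiom schemes.
\<close>

datatype fm =
    FMem nat nat
  | FEq nat nat
  | FNot fm
  | FAnd fm fm
  | FAll nat fm

primrec sat :: "'a::membership set \<Rightarrow> fm \<Rightarrow> (nat \<Rightarrow> 'a) \<Rightarrow> bool" where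
  "sat M (FMem i j) e \<longleftrightarrow> e i \<^bold>\<in> e j"
| "sat M (FEq i j) e \<longleftrightarrow> e i = e j"
| "sat M (FNot p) e \<longleftrightarrow> \<not> sat M p e"
| "sat M (FAnd p q) e \<longleftrightarrow> sat M p e \<and> sat M q e"
| "sat M (FAll i p) e \<longleftrightarrow> (\<forall>x\<in>M. sat M p (e(i := x)))"


text \<open>
  From here on, every notion is relativized to a class \<open>M\<close>: a constant with first argument \<open>M\<close>
  expresses the usual set-theoretic notion as evaluated in \<open>M\<close>.
\<close>

definition is_subset :: "'a::membership set \<Rightarrow> 'a \<Rightarrow> 'a \<Rightarrow> bool" where
  "is_subset M x y \<longleftrightarrow> (\<forall>z\<in>M. z \<^bold>\<in> x \<longrightarrow> z \<^bold>\<in> y)"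

definition is_emptyset :: "'a::membership set \<Rightarrow> 'a \<Rightarrow> bool" where
  "is_emptyset M x \<longleftrightarrow> (\<forall>z\<in>M. \<not> z \<^bold>\<in> x)"

text \<open>In the following definitions the last argument is the set being described.\<close>

definition is_inter :: "'a::membership set \<Rightarrow> 'a \<Rightarrow> 'a \<Rightarrow> 'a \<Rightarrow> bool" where
  "is_inter M x y z \<longleftrightarrow> (\<forall>w\<in>M. w \<^bold>\<in> z \<longleftrightarrow> w \<^bold>\<in> x \<and> w \<^bold>\<in> y)"

definition is_diff :: "'a::membership set \<Rightarrow> 'a \<Rightarrow> 'a \<Rightarrow> 'a \<Rightarrow> bool" where
  "is_diff M x y z \<longleftrightarrow> (\<forall>w\<in>M. w \<^bold>\<in> z \<longleftrightarrow> w \<^bold>\<in> x \<and> \<not> w \<^bold>\<in> y)"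

definition is_upair :: "'a::membership set \<Rightarrow> 'a \<Rightarrow> 'a \<Rightarrow> 'a \<Rightarrow> bool" where
  "is_upair M x y z \<longleftrightarrow> (\<forall>w\<in>M. w \<^bold>\<in> z \<longleftrightarrow> w = x \<or> w = y)"

definition is_succ :: "'a::membership set \<Rightarrow> 'a \<Rightarrow> 'a \<Rightarrow> bool" where
  "is_succ M x z \<longleftrightarrow> (\<forall>w\<in>M. w \<^bold>\<in> z \<longleftrightarrow> w \<^bold>\<in> x \<or> w = x)"

text \<open>Kuratowski pairs.\<close>

definition is_pair :: "'a::membership set \<Rightarrow> 'a \<Rightarrow> 'a \<Rightarrow> 'a \<Rightarrow> bool" where
  "is_pair M x y p \<longleftrightarrow>
     (\<exists>u\<in>M. \<exists>v\<in>M. is_upair M x x u \<and> is_upair M x y v \<and> is_upair M u v p)"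


definition ZFC_model :: "'a::membership set \<Rightarrow> bool" where
  "ZFC_model M \<longleftrightarrow>
     \<comment> \<open>Extensionality\<close>
     (\<forall>x\<in>M. \<forall>y\<in>M. (\<forall>z\<in>M. z \<^bold>\<in> x \<longleftrightarrow> z \<^bold>\<in> y) \<longrightarrow> x = y) \<and>
     \<comment> \<open>Foundation\<close>
     (\<forall>x\<in>M. \<not> is_emptyset M x \<longrightarrow> (\<exists>y\<in>M. y \<^bold>\<in> x \<and> (\<forall>z\<in>M. z \<^bold>\<in> x \<longrightarrow> \<not> z \<^bold>\<in> y))) \<and>
     \<comment> \<open>Pairing\<close>
     (\<forall>x\<in>M. \<forall>y\<in>M. \<exists>z\<in>M. is_upair M x y z) \<and>
     \<comment> \<open>Union\<close>
     (\<forall>x\<in>M. \<exists>u\<in>M. \<forall>z\<in>M. z \<^bold>\<in> u \<longleftrightarrow> (\<exists>y\<in>M. y \<^bold>\<in> x \<and> z \<^bold>\<in> y)) \<and>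
     \<comment> \<open>Power set\<close>
     (\<forall>x\<in>M. \<exists>p\<in>M. \<forall>z\<in>M. z \<^bold>\<in> p \<longleftrightarrow> is_subset M z x) \<and>
     \<comment> \<open>Infinity\<close>
     (\<exists>w\<in>M. (\<exists>o'\<in>M. is_emptyset M o' \<and> o' \<^bold>\<in> w) \<and>
            (\<forall>x\<in>M. x \<^bold>\<in> w \<longrightarrow> (\<exists>s\<in>M. is_succ M x s \<and> s \<^bold>\<in> w))) \<and>
     \<comment> \<open>Separation scheme: variable \<open>0\<close> is the element, all other variables are parameters\<close>
     (\<forall>\<phi> e. range e \<subseteq> M \<longrightarrow>
        (\<forall>a\<in>M. \<exists>b\<in>M. \<forall>x\<in>M. x \<^bold>\<in> b \<longleftrightarrow> x \<^bold>\<in> a \<and> sat M \<phi> (e(0 := x)))) \<and>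
     \<comment> \<open>Replacement scheme: variables \<open>0\<close>, \<open>1\<close> are argument and value, all others are parameters\<close>
     (\<forall>\<phi> e. range e \<subseteq> M \<longrightarrow>
        (\<forall>a\<in>M. (\<forall>x\<in>M. x \<^bold>\<in> a \<longrightarrow> (\<exists>!y. y \<in> M \<and> sat M \<phi> (e(0 := x, 1 := y)))) \<longrightarrow>
           (\<exists>b\<in>M. \<forall>y\<in>M. y \<^bold>\<in> b \<longleftrightarrow> (\<exists>x\<in>M. x \<^bold>\<in> a \<and> sat M \<phi> (e(0 := x, 1 := y)))))) \<and>
     \<comment> \<open>Choice: every family of nonempty, pairwise disjoint sets has a transversal\<close>
     (\<forall>a\<in>M. (\<forall>x\<in>M. x \<^bold>\<in> a \<longrightarrow> \<not> is_emptyset M x) \<and>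
            (\<forall>x\<in>M. \<forall>y\<in>M. x \<^bold>\<in> a \<and> y \<^bold>\<in> a \<and> x \<noteq> y \<longrightarrow> \<not> (\<exists>z\<in>M. z \<^bold>\<in> x \<and> z \<^bold>\<in> y)) \<longrightarrow>
        (\<exists>c\<in>M. \<forall>x\<in>M. x \<^bold>\<in> a \<longrightarrow> (\<exists>!z. z \<in> M \<and> z \<^bold>\<in> x \<and> z \<^bold>\<in> c)))"


definition is_ordinal :: "'a::membership set \<Rightarrow> 'a \<Rightarrow> bool" where
  "is_ordinal M \<alpha> \<longleftrightarrow>
     \<comment> \<open>transitive\<close>
     (\<forall>x\<in>M. x \<^bold>\<in> \<alpha> \<longrightarrow> is_subset M x \<alpha>) \<and>
     \<comment> \<open>strictly linearly ordered by membership\<close>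
     (\<forall>x\<in>M. x \<^bold>\<in> \<alpha> \<longrightarrow> \<not> x \<^bold>\<in> x) \<and>
     (\<forall>x\<in>M. \<forall>y\<in>M. \<forall>z\<in>M. x \<^bold>\<in> \<alpha> \<and> y \<^bold>\<in> \<alpha> \<and> z \<^bold>\<in> \<alpha> \<and> x \<^bold>\<in> y \<and> y \<^bold>\<in> z \<longrightarrow> x \<^bold>\<in> z) \<and>
     (\<forall>x\<in>M. \<forall>y\<in>M. x \<^bold>\<in> \<alpha> \<and> y \<^bold>\<in> \<alpha> \<longrightarrow> x \<^bold>\<in> y \<or> x = y \<or> y \<^bold>\<in> x) \<and>
     \<comment> \<open>nonempty subsets have a least element\<close>
     (\<forall>s\<in>M. is_subset M s \<alpha> \<and> \<not> is_emptyset M s \<longrightarrow>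
        (\<exists>x\<in>M. x \<^bold>\<in> s \<and> (\<forall>y\<in>M. y \<^bold>\<in> s \<longrightarrow> x = y \<or> x \<^bold>\<in> y)))"

definition maps_to :: "'a::membership set \<Rightarrow> 'a \<Rightarrow> 'a \<Rightarrow> 'a \<Rightarrow> bool" where
  "maps_to M f x y \<longleftrightarrow> (\<exists>p\<in>M. is_pair M x y p \<and> p \<^bold>\<in> f)"

definition is_function :: "'a::membership set \<Rightarrow> 'a \<Rightarrow> 'a \<Rightarrow> 'a \<Rightarrow> bool" where
  "is_function M f a b \<longleftrightarrow>
     (\<forall>p\<in>M. p \<^bold>\<in> f \<longrightarrow> (\<exists>x\<in>M. \<exists>y\<in>M. x \<^bold>\<in> a \<and> y \<^bold>\<in> b \<and> is_pair M x y p)) \<and>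
     (\<forall>x\<in>M. x \<^bold>\<in> a \<longrightarrow> (\<exists>!y. y \<in> M \<and> maps_to M f x y))"

definition is_bijection :: "'a::membership set \<Rightarrow> 'a \<Rightarrow> 'a \<Rightarrow> 'a \<Rightarrow> bool" where
  "is_bijection M f a b \<longleftrightarrow>
     is_function M f a b \<and> (\<forall>y\<in>M. y \<^bold>\<in> b \<longrightarrow> (\<exists>!x. x \<in> M \<and> maps_to M f x y))"

definition equinumerous :: "'a::membership set \<Rightarrow> 'a \<Rightarrow> 'a \<Rightarrow> bool" where
  "equinumerous M a b \<longleftrightarrow> (\<exists>f\<in>M. is_bijection M f a b)"

definition is_cardinality :: "'a::membership set \<Rightarrow> 'a \<Rightarrow> 'a \<Rightarrow> bool" where
  "is_cardinality M a \<beta> \<longleftrightarrow>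
     is_ordinal M \<beta> \<and> equinumerous M a \<beta> \<and> (\<forall>\<gamma>\<in>M. \<gamma> \<^bold>\<in> \<beta> \<longrightarrow> \<not> equinumerous M a \<gamma>)"

text \<open>
  The bounds \<open>\<delta>\<close> here and \<open>\<kappa>\<close> in \<open>is_complete_on\<close> below are ordinals that need not themselves
  belong to \<open>M\<close>; only their elements lying in \<open>M\<close> matter.
\<close>

definition size_less :: "'a::membership set \<Rightarrow> 'a \<Rightarrow> 'a \<Rightarrow> bool" where
  "size_less M a \<delta> \<longleftrightarrow> (\<exists>\<beta>\<in>M. is_cardinality M a \<beta> \<and> \<beta> \<^bold>\<in> \<delta>)"

definition approximation_property ::
  "'a::membership \<Rightarrow> 'a set \<Rightarrow> 'a set \<Rightarrow> bool" where
  "approximation_property \<delta> M N \<longleftrightarrow>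
     (\<forall>A\<in>N. (\<forall>x. x \<^bold>\<in> A \<longrightarrow> x \<in> M) \<and>
            (\<forall>a\<in>M. size_less M a \<delta> \<longrightarrow> (\<exists>b\<in>M. \<forall>x. x \<^bold>\<in> b \<longleftrightarrow> x \<^bold>\<in> A \<and> x \<^bold>\<in> a)) \<longrightarrow>
        A \<in> M)"


definition is_filter_on :: "'a::membership set \<Rightarrow> 'a \<Rightarrow> 'a \<Rightarrow> bool" where
  "is_filter_on M D \<nu> \<longleftrightarrow>
     (\<forall>X\<in>M. X \<^bold>\<in> \<nu> \<longrightarrow> is_subset M X D \<and> \<not> is_emptyset M X) \<and>
     D \<^bold>\<in> \<nu> \<and>
     (\<forall>X\<in>M. \<forall>Y\<in>M. X \<^bold>\<in> \<nu> \<and> is_subset M X Y \<and> is_subset M Y D \<longrightarrow> Y \<^bold>\<in> \<nu>) \<and>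
     (\<forall>X\<in>M. \<forall>Y\<in>M. X \<^bold>\<in> \<nu> \<and> Y \<^bold>\<in> \<nu> \<longrightarrow> (\<exists>Z\<in>M. is_inter M X Y Z \<and> Z \<^bold>\<in> \<nu>))"

text \<open>
  Closure under intersections of sequences \<open>\<langle>X\<^sub>\<alpha> : \<alpha> < \<beta>\<rangle>\<close> of members, for all \<open>\<beta> < \<kappa>\<close>, the
  sequence being an element \<open>g\<close> of \<open>M\<close>. Intersections are taken within \<open>D\<close>, so the empty
  intersection is \<open>D\<close>.
\<close>

definition is_complete_on :: "'a::membership set \<Rightarrow> 'a \<Rightarrow> 'a \<Rightarrow> 'a \<Rightarrow> bool" where
  "is_complete_on M \<kappa> D \<nu> \<longleftrightarrow>
     (\<forall>\<beta>\<in>M. \<forall>g\<in>M. \<beta> \<^bold>\<in> \<kappa> \<and> is_function M g \<beta> \<nu> \<longrightarrow>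
        (\<exists>Y\<in>M. Y \<^bold>\<in> \<nu> \<and>
           (\<forall>x\<in>M. x \<^bold>\<in> Y \<longleftrightarrow>
              x \<^bold>\<in> D \<and> (\<forall>\<alpha>\<in>M. \<forall>X\<in>M. \<alpha> \<^bold>\<in> \<beta> \<and> maps_to M g \<alpha> X \<longrightarrow> x \<^bold>\<in> X))))"

text \<open>\<open>\<nu>\<close> decides all subsets of \<open>D\<close> lying in \<open>M\<close>; here \<open>\<nu>\<close> need not be an element of \<open>M\<close>.\<close>

definition measures_subsets :: "'a::membership set \<Rightarrow> 'a \<Rightarrow> 'a \<Rightarrow> bool" where
  "measures_subsets M D \<nu> \<longleftrightarrow>
     (\<forall>X\<in>M. is_subset M X D \<longrightarrow> X \<^bold>\<in> \<nu> \<or> (\<exists>Y\<in>M. is_diff M D X Y \<and> Y \<^bold>\<in> \<nu>))"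

text \<open>A measure is a \<open>\<kappa>\<close>-complete ultrafilter; principal ones are not excluded.\<close>

definition is_measure_on :: "'a::membership set \<Rightarrow> 'a \<Rightarrow> 'a \<Rightarrow> 'a \<Rightarrow> bool" where
  "is_measure_on M \<kappa> D \<mu> \<longleftrightarrow>
     is_filter_on M D \<mu> \<and> is_complete_on M \<kappa> D \<mu> \<and> measures_subsets M D \<mu>"

end

theory Submission imports Defs begin

text \<open>
  Since \<open>P(D)\<close> as computed in \<open>V\<close> is an element of \<open>Vbar\<close>, so is \<open>\<nu> \<inter> V\<close>, and it suffices to
  approximate it. If \<open>a \<in> V\<close> has size less than \<open>\<delta>\<close> in \<open>V\<close>, an enumeration of \<open>a\<close> in \<open>V\<close> yields
  in \<open>Vbar\<close> a sequence of length less than \<open>\<kappa>\<close> picking, for each \<open>X \<in> a\<close>, whichever of \<open>D \<inter> X\<close>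
  and \<open>D - X\<close> belongs to \<open>\<nu>\<close>. By completeness its intersection is nonempty, and for any \<open>d\<close> in
  it a subset \<open>X \<in> a\<close> of \<open>D\<close> belongs to \<open>\<nu>\<close> iff \<open>d \<in> X\<close>. Hence \<open>\<nu> \<inter> a\<close> is defined in \<open>V\<close> from
  \<open>a\<close>, \<open>D\<close> and \<open>d\<close>.
\<close>

section \<open>Ordered pairs and functions described by their elements\<close>

text \<open>Unrelativized notions, with which the relativized ones agree in every transitive model.\<close>

definition kpair :: "'a::membership \<Rightarrow> 'a \<Rightarrow> 'a \<Rightarrow> bool" where
  "kpair x y p \<longleftrightarrow> (\<exists>u v. (\<forall>w. w \<^bold>\<in> u \<longleftrightarrow> w = x) \<and> (\<forall>w. w \<^bold>\<in> v \<longleftrightarrow> w = x \<or> w = y) \<and>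
     (\<forall>w. w \<^bold>\<in> p \<longleftrightarrow> w = u \<or> w = v))"

definition kmaps :: "'a::membership \<Rightarrow> 'a \<Rightarrow> 'a \<Rightarrow> bool" where
  "kmaps f x y \<longleftrightarrow> (\<exists>p. kpair x y p \<and> p \<^bold>\<in> f)"

definition kfun :: "'a::membership \<Rightarrow> 'a \<Rightarrow> 'a \<Rightarrow> bool" where
  "kfun f a b \<longleftrightarrow> (\<forall>p. p \<^bold>\<in> f \<longrightarrow> (\<exists>x y. x \<^bold>\<in> a \<and> y \<^bold>\<in> b \<and> kpair x y p)) \<and>
     (\<forall>x. x \<^bold>\<in> a \<longrightarrow> (\<exists>!y. kmaps f x y))"

text \<open>Two lists of the elements of the same object \<open>p\<close> are compared, and then the
  elements of those elements. This is pure logic, valid for an arbitrary membership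
  relation.\<close>

lemma kpair_inject:
  assumes "kpair x y p" "kpair x' y' p"
  shows "x = x' \<and> y = y'"
proof -
  obtain u v where uv: "\<forall>w. w \<^bold>\<in> u \<longleftrightarrow> w = x" "\<forall>w. w \<^bold>\<in> v \<longleftrightarrow> w = x \<or> w = y"
    "\<forall>w. w \<^bold>\<in> p \<longleftrightarrow> w = u \<or> w = v" using assms(1) unfolding kpair_def by blast
  obtain u' v' where uv': "\<forall>w. w \<^bold>\<in> u' \<longleftrightarrow> w = x'" "\<forall>w. w \<^bold>\<in> v' \<longleftrightarrow> w = x' \<or> w = y'"
    "\<forall>w. w \<^bold>\<in> p \<longleftrightarrow> w = u' \<or> w = v'" using assms(2) unfolding kpair_def by blast
  show ?thesis using uv uv' by metis
qed

lemma kfun_range: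
  assumes "kfun f a b" "kmaps f x y"
  shows "x \<^bold>\<in> a \<and> y \<^bold>\<in> b"
  using assms kpair_inject unfolding kfun_def kmaps_def by blast

lemma kfun_codomain_mono:
  assumes "kfun f a b" "\<And>y. y \<^bold>\<in> b \<Longrightarrow> y \<^bold>\<in> c"
  shows "kfun f a c"
  using assms unfolding kfun_def by blast

section \<open>Formulas for pairs and function values\<close>

definition FEx :: "nat \<Rightarrow> fm \<Rightarrow> fm" where
  "FEx i p = FNot (FAll i (FNot p))"

definition FOr :: "fm \<Rightarrow> fm \<Rightarrow> fm" where
  "FOr p q = FNot (FAnd (FNot p) (FNot q))"

definition FIff :: "fm \<Rightarrow> fm \<Rightarrow> fm" where
  "FIff p q = FOr (FAnd p q) (FAnd (FNot p) (FNot q))"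

lemma sat_derived [simp]:
  "sat M (FEx i p) e \<longleftrightarrow> (\<exists>x\<in>M. sat M p (e(i := x)))"
  "sat M (FOr p q) e \<longleftrightarrow> sat M p e \<or> sat M q e"
  "sat M (FIff p q) e \<longleftrightarrow> (sat M p e \<longleftrightarrow> sat M q e)"
  by (auto simp: FEx_def FOr_def FIff_def)

text \<open>The formulas below use the bound variables \<open>8\<close> to \<open>11\<close>; their arguments must be smaller,
  except in the use of \<open>pair_fm\<close> inside \<open>maps_fm\<close>.\<close>

definition upair_fm :: "nat \<Rightarrow> nat \<Rightarrow> nat \<Rightarrow> fm" where
  "upair_fm i j k = FAll 8 (FIff (FMem 8 k) (FOr (FEq 8 i) (FEq 8 j)))"

definition pair_fm :: "nat \<Rightarrow> nat \<Rightarrow> nat \<Rightarrow> fm" where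
  "pair_fm i j k = FEx 9 (FEx 10 (FAnd (upair_fm i i 9) (FAnd (upair_fm i j 10) (upair_fm 9 10 k))))"

definition maps_fm :: "nat \<Rightarrow> nat \<Rightarrow> nat \<Rightarrow> fm" where
  "maps_fm f i j = FEx 11 (FAnd (pair_fm i j 11) (FMem 11 f))"

lemma sat_upair_fm:
  assumes "i \<noteq> 8" "j \<noteq> 8" "k \<noteq> 8"
  shows "sat M (upair_fm i j k) e \<longleftrightarrow> is_upair M (e i) (e j) (e k)"
  using assms by (simp add: upair_fm_def is_upair_def)

text \<open>The case \<open>k = 11\<close> serves \<open>maps_fm\<close>, whose bound variable for
  the pair differs from \<open>8\<close>, \<open>9\<close> and \<open>10\<close>, so that nothing is
  captured.\<close>

lemma sat_pair_fm:
  assumes "i < 8" "j < 8" "k < 8 \<or> k = 11"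
  shows "sat M (pair_fm i j k) e \<longleftrightarrow> is_pair M (e i) (e j) (e k)"
proof -
  have "i \<noteq> 8" "j \<noteq> 8" "k \<noteq> 8" "i \<noteq> 9" "j \<noteq> 9" "k \<noteq> 9" "i \<noteq> 10" "j \<noteq> 10" "k \<noteq> 10"
    using assms by auto
  then show ?thesis by (simp add: pair_fm_def is_pair_def sat_upair_fm)
qed

lemma sat_maps_fm:
  assumes "f < 8" "i < 8" "j < 8"
  shows "sat M (maps_fm f i j) e \<longleftrightarrow> maps_to M (e f) (e i) (e j)"
proof -
  have "f \<noteq> 11" "i \<noteq> 11" "j \<noteq> 11" using assms by auto
  then show ?thesis using assms by (simp add: maps_fm_def maps_to_def sat_pair_fm)
qed

section \<open>Absoluteness and set existence in a transitive model\<close>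

locale transitive_model =
  fixes M :: "'a::membership set"
  assumes trans: "transitive_class M" and zfc: "ZFC_model M"
begin

lemma memD: "x \<in> M \<Longrightarrow> y \<^bold>\<in> x \<Longrightarrow> y \<in> M"
  using trans unfolding transitive_class_def by blast

lemma ball_mem_iff: "a \<in> M \<Longrightarrow> (\<forall>x\<in>M. x \<^bold>\<in> a \<longrightarrow> Q x) \<longleftrightarrow> (\<forall>x. x \<^bold>\<in> a \<longrightarrow> Q x)"
  using memD by blast

lemma extensionality:
  assumes "x \<in> M" "y \<in> M" "\<And>z. z \<^bold>\<in> x \<longleftrightarrow> z \<^bold>\<in> y"
  shows "x = y"
proof -
  have "\<forall>x\<in>M. \<forall>y\<in>M. (\<forall>z\<in>M. z \<^bold>\<in> x \<longleftrightarrow> z \<^bold>\<in> y) \<longrightarrow> x = y"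
    using zfc unfolding ZFC_model_def by (elim conjE)
  then show ?thesis using assms by blast
qed

lemma is_upair_iff:
  assumes "x \<in> M" "y \<in> M" "z \<in> M"
  shows "is_upair M x y z \<longleftrightarrow> (\<forall>w. w \<^bold>\<in> z \<longleftrightarrow> w = x \<or> w = y)"
  using assms memD unfolding is_upair_def by blast

lemma upair_exists:
  assumes "x \<in> M" "y \<in> M"
  obtains z where "z \<in> M" "is_upair M x y z"
proof -
  have "\<forall>x\<in>M. \<forall>y\<in>M. \<exists>z\<in>M. is_upair M x y z"
    using zfc unfolding ZFC_model_def by (elim conjE)
  then show ?thesis using assms that by blast
qed

text \<open>The condition \<open>z \<in> M\<close> stays because power sets are not absolute: the
  one formed in \<open>M\<close> collects only the subsets of \<open>x\<close> that lie in
  \<open>M\<close>.\<close>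

lemma power_set:
  assumes "x \<in> M"
  obtains p where "p \<in> M" "\<And>z. z \<^bold>\<in> p \<longleftrightarrow> z \<in> M \<and> (\<forall>w. w \<^bold>\<in> z \<longrightarrow> w \<^bold>\<in> x)"
proof -
  have "\<forall>x\<in>M. \<exists>p\<in>M. \<forall>z\<in>M. z \<^bold>\<in> p \<longleftrightarrow> is_subset M z x"
    using zfc unfolding ZFC_model_def by (elim conjE)
  then obtain p where "p \<in> M" "\<forall>z\<in>M. z \<^bold>\<in> p \<longleftrightarrow> is_subset M z x" using assms by blast
  then show ?thesis using memD that[of p] unfolding is_subset_def by blast
qed

lemma separation:
  assumes "range e \<subseteq> M" "a \<in> M"
  obtains b where "b \<in> M" "\<And>x. x \<^bold>\<in> b \<longleftrightarrow> x \<^bold>\<in> a \<and> sat M \<phi> (e(0 := x))"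
proof -
  have "\<forall>\<phi> e. range e \<subseteq> M \<longrightarrow>
        (\<forall>a\<in>M. \<exists>b\<in>M. \<forall>x\<in>M. x \<^bold>\<in> b \<longleftrightarrow> x \<^bold>\<in> a \<and> sat M \<phi> (e(0 := x)))"
    using zfc unfolding ZFC_model_def by (elim conjE)
  then obtain b where "b \<in> M" "\<forall>x\<in>M. x \<^bold>\<in> b \<longleftrightarrow> x \<^bold>\<in> a \<and> sat M \<phi> (e(0 := x))"
    using assms by blast
  then show ?thesis using memD assms(2) that[of b] by blast
qed

text \<open>By transitivity the elements of \<open>a\<close> lie in \<open>M\<close>, so the
  quantifier over arguments is no longer relativized. For values \<open>y \<in> M\<close> is stated,
  since satisfaction alone does not force it.\<close>

lemma replacement:
  assumes "range e \<subseteq> M" "a \<in> M"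
    and "\<And>x. x \<^bold>\<in> a \<Longrightarrow> \<exists>!y. y \<in> M \<and> sat M \<phi> (e(0 := x, 1 := y))"
  obtains b where "b \<in> M"
    "\<And>y. y \<^bold>\<in> b \<longleftrightarrow> y \<in> M \<and> (\<exists>x. x \<^bold>\<in> a \<and> sat M \<phi> (e(0 := x, 1 := y)))"
proof -
  have "\<forall>\<phi> e. range e \<subseteq> M \<longrightarrow>
        (\<forall>a\<in>M. (\<forall>x\<in>M. x \<^bold>\<in> a \<longrightarrow> (\<exists>!y. y \<in> M \<and> sat M \<phi> (e(0 := x, 1 := y)))) \<longrightarrow>
           (\<exists>b\<in>M. \<forall>y\<in>M. y \<^bold>\<in> b \<longleftrightarrow> (\<exists>x\<in>M. x \<^bold>\<in> a \<and> sat M \<phi> (e(0 := x, 1 := y)))))"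
    using zfc unfolding ZFC_model_def by (elim conjE)
  from this[rule_format, OF assms(1,2), of \<phi>] assms(3)
  obtain b where "b \<in> M" "\<forall>y\<in>M. y \<^bold>\<in> b \<longleftrightarrow> (\<exists>x\<in>M. x \<^bold>\<in> a \<and> sat M \<phi> (e(0 := x, 1 := y)))"
    by blast
  then show ?thesis using memD assms(2) that[of b] by blast
qed

lemma inter_exists:
  assumes "x \<in> M" "y \<in> M"
  obtains z where "z \<in> M" "\<And>w. w \<^bold>\<in> z \<longleftrightarrow> w \<^bold>\<in> x \<and> w \<^bold>\<in> y"
  \<comment> \<open>The constant assignment makes variable \<open>1\<close> denote
    \<open>y\<close>.\<close>
  using separation[of "\<lambda>_. y" x "FMem 0 1"] assms by auto

text \<open>The two inner sets of a Kuratowski pair are elements of \<open>p\<close>, so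
  transitivity places them in \<open>M\<close>.\<close>

lemma is_pair_iff:
  assumes "x \<in> M" "y \<in> M" "p \<in> M"
  shows "is_pair M x y p \<longleftrightarrow> kpair x y p"
proof
  assume "is_pair M x y p"
  then show "kpair x y p"
    using assms unfolding is_pair_def kpair_def by (auto simp: is_upair_iff)
next
  assume "kpair x y p"
  then obtain u v where uv: "\<forall>w. w \<^bold>\<in> u \<longleftrightarrow> w = x" "\<forall>w. w \<^bold>\<in> v \<longleftrightarrow> w = x \<or> w = y"
    "\<forall>w. w \<^bold>\<in> p \<longleftrightarrow> w = u \<or> w = v" unfolding kpair_def by blast
  then have "u \<in> M" "v \<in> M" using memD assms(3) by blast+
  then show "is_pair M x y p"
    using uv assms unfolding is_pair_def by (auto simp: is_upair_iff)
qed

lemma kpair_memD: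
  assumes "kpair x y p" "p \<in> M"
  shows "x \<in> M \<and> y \<in> M"
  using assms memD unfolding kpair_def by metis

lemma kmaps_memD:
  assumes "kmaps f x y" "f \<in> M"
  shows "x \<in> M \<and> y \<in> M"
  using assms kpair_memD memD unfolding kmaps_def by blast

lemma kpair_exists:
  assumes "x \<in> M" "y \<in> M"
  obtains p where "p \<in> M" "kpair x y p"
proof -
  obtain u where u: "u \<in> M" "is_upair M x x u" using assms upair_exists by blast
  obtain v where v: "v \<in> M" "is_upair M x y v" using assms upair_exists by blast
  obtain p where p: "p \<in> M" "is_upair M u v p" using u v upair_exists by blast
  have "is_pair M x y p" using u v p unfolding is_pair_def by blast
  then show ?thesis using that p(1) is_pair_iff assms by blast
qed

text \<open>Since \<open>kpair\<close> only lists elements, identity comes from extensionality in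
  \<open>M\<close>, applied first to the two inner sets and then to the pairs.\<close>

lemma kpair_unique:
  assumes "kpair x y p" "kpair x y q" "p \<in> M" "q \<in> M"
  shows "p = q"
proof -
  obtain u v where uv: "\<forall>w. w \<^bold>\<in> u \<longleftrightarrow> w = x" "\<forall>w. w \<^bold>\<in> v \<longleftrightarrow> w = x \<or> w = y"
    "\<forall>w. w \<^bold>\<in> p \<longleftrightarrow> w = u \<or> w = v" using assms(1) unfolding kpair_def by blast
  obtain u' v' where uv': "\<forall>w. w \<^bold>\<in> u' \<longleftrightarrow> w = x" "\<forall>w. w \<^bold>\<in> v' \<longleftrightarrow> w = x \<or> w = y"
    "\<forall>w. w \<^bold>\<in> q \<longleftrightarrow> w = u' \<or> w = v'" using assms(2) unfolding kpair_def by blast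
  have "u \<in> M" "v \<in> M" "u' \<in> M" "v' \<in> M" using memD assms(3,4) uv(3) uv'(3) by blast+
  then have "u = u'" "v = v'" using extensionality uv uv' by auto
  then show ?thesis using extensionality[OF assms(3,4)] uv(3) uv'(3) by auto
qed

lemma maps_to_iff:
  assumes "f \<in> M" "x \<in> M" "y \<in> M"
  shows "maps_to M f x y \<longleftrightarrow> kmaps f x y"
  using assms is_pair_iff memD unfolding maps_to_def kmaps_def by blast

text \<open>All witnesses are elements of \<open>a\<close> or \<open>b\<close>, or coordinates of
  pairs in \<open>f\<close>, hence in \<open>M\<close>. As \<open>kfun\<close> does not mention
  \<open>M\<close>, functions can be moved between transitive models.\<close>

lemma is_function_iff:
  assumes "f \<in> M" "a \<in> M" "b \<in> M"
  shows "is_function M f a b \<longleftrightarrow> kfun f a b"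
proof -
  have maps: "(\<exists>!y. y \<in> M \<and> maps_to M f x y) \<longleftrightarrow> (\<exists>!y. kmaps f x y)" if "x \<in> M" for x
    using maps_to_iff[OF assms(1) that] kmaps_memD[OF _ assms(1)] by metis
  have pair: "(\<exists>x\<in>M. \<exists>y\<in>M. x \<^bold>\<in> a \<and> y \<^bold>\<in> b \<and> is_pair M x y p) \<longleftrightarrow>
      (\<exists>x y. x \<^bold>\<in> a \<and> y \<^bold>\<in> b \<and> kpair x y p)" if "p \<in> M" for p
    using is_pair_iff[OF _ _ that] memD[OF assms(2)] memD[OF assms(3)] by blast
  have "is_function M f a b \<longleftrightarrow>
      (\<forall>p\<in>M. p \<^bold>\<in> f \<longrightarrow> (\<exists>x y. x \<^bold>\<in> a \<and> y \<^bold>\<in> b \<and> kpair x y p)) \<and>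
      (\<forall>x\<in>M. x \<^bold>\<in> a \<longrightarrow> (\<exists>!y. kmaps f x y))"
    unfolding is_function_def by (simp only: maps pair cong: ball_cong)
  also have "\<dots> \<longleftrightarrow> kfun f a b"
    unfolding kfun_def by (simp only: ball_mem_iff[OF assms(1)] ball_mem_iff[OF assms(2)])
  finally show ?thesis .
qed

text \<open>Separation from \<open>D\<close>; for empty \<open>\<beta>\<close> the result has the
  same elements as \<open>D\<close>, in agreement with \<open>is_complete_on\<close>.\<close>

lemma sequence_intersection_exists:
  assumes "D \<in> M" "g \<in> M" "\<beta> \<in> M"
  obtains Y where "Y \<in> M"
    "\<And>x. x \<^bold>\<in> Y \<longleftrightarrow> x \<^bold>\<in> D \<and> (\<forall>\<alpha> X. \<alpha> \<^bold>\<in> \<beta> \<and> kmaps g \<alpha> X \<longrightarrow> x \<^bold>\<in> X)"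
proof -
  let ?e = "(\<lambda>_. g)(2 := \<beta>)"
  \<comment> \<open>Variable \<open>0\<close> is the candidate point, \<open>1\<close> is
    \<open>g\<close>, \<open>2\<close> is \<open>\<beta>\<close>, and \<open>3\<close>,
    \<open>4\<close> run over indices and values. The implication is written as a negated
    conjunction.\<close>
  let ?\<phi> = "FAll 3 (FAll 4 (FNot (FAnd (FMem 3 2) (FAnd (maps_fm 1 3 4) (FNot (FMem 0 4))))))"
  have "range ?e \<subseteq> M" using assms by auto
  then obtain Y where Y: "Y \<in> M" "\<And>x. x \<^bold>\<in> Y \<longleftrightarrow> x \<^bold>\<in> D \<and> sat M ?\<phi> (?e(0 := x))"
    using separation[of ?e D ?\<phi>] assms(1) by blast
  have "sat M ?\<phi> (?e(0 := x)) \<longleftrightarrow> (\<forall>\<alpha> X. \<alpha> \<^bold>\<in> \<beta> \<and> kmaps g \<alpha> X \<longrightarrow> x \<^bold>\<in> X)" for x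
    using maps_to_iff[OF assms(2)] kmaps_memD[OF _ assms(2)]
    by (simp add: sat_maps_fm) blast
  then show ?thesis using Y that by blast
qed

text \<open>Each index has exactly one preimage under \<open>f\<close>, and each preimage exactly
  one side in \<open>\<nu>\<close>. The assignment is therefore functional, and replacement along
  \<open>\<beta>\<close> yields its graph.\<close>

lemma choice_of_sides:
  assumes M: "f \<in> M" "D \<in> M" "\<nu> \<in> M" "\<beta> \<in> M"
    and pre: "\<And>\<alpha>. \<alpha> \<^bold>\<in> \<beta> \<Longrightarrow> \<exists>!X. kmaps f X \<alpha>"
    and side: "\<And>X \<alpha>. kmaps f X \<alpha> \<Longrightarrow> \<alpha> \<^bold>\<in> \<beta> \<Longrightarrow> \<exists>!Z. Z \<^bold>\<in> \<nu> \<and>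
       ((\<forall>w. w \<^bold>\<in> Z \<longleftrightarrow> w \<^bold>\<in> D \<and> w \<^bold>\<in> X) \<or> (\<forall>w. w \<^bold>\<in> Z \<longleftrightarrow> w \<^bold>\<in> D \<and> \<not> w \<^bold>\<in> X))"
  obtains g where "g \<in> M" "kfun g \<beta> \<nu>"
    "\<And>\<alpha> X. \<alpha> \<^bold>\<in> \<beta> \<Longrightarrow> kmaps f X \<alpha> \<Longrightarrow> \<exists>Z. kmaps g \<alpha> Z \<and> Z \<^bold>\<in> \<nu> \<and>
       ((\<forall>w. w \<^bold>\<in> Z \<longleftrightarrow> w \<^bold>\<in> D \<and> w \<^bold>\<in> X) \<or> (\<forall>w. w \<^bold>\<in> Z \<longleftrightarrow> w \<^bold>\<in> D \<and> \<not> w \<^bold>\<in> X))"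
proof -
  define S where "S X Z \<longleftrightarrow> Z \<^bold>\<in> \<nu> \<and>
       ((\<forall>w. w \<^bold>\<in> Z \<longleftrightarrow> w \<^bold>\<in> D \<and> w \<^bold>\<in> X) \<or> (\<forall>w. w \<^bold>\<in> Z \<longleftrightarrow> w \<^bold>\<in> D \<and> \<not> w \<^bold>\<in> X))" for X Z
  \<comment> \<open>\<open>T\<close> is the relation that \<open>g\<close> will realize: pass from
    \<open>\<alpha>\<close> back along \<open>f\<close> to \<open>X\<close>, then to the side of
    \<open>X\<close> in \<open>\<nu>\<close>.\<close>
  define T where "T \<alpha> Z \<longleftrightarrow> (\<exists>X. kmaps f X \<alpha> \<and> S X Z)" for \<alpha> Z
  have T_unique: "\<exists>!Z. T \<alpha> Z" if "\<alpha> \<^bold>\<in> \<beta>" for \<alpha>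
    using pre[OF that] side[OF _ that] unfolding T_def S_def[symmetric] by metis
  have T_mem: "Z \<^bold>\<in> \<nu>" if "T \<alpha> Z" for \<alpha> Z
    using that unfolding T_def S_def by blast
  let ?e = "(\<lambda>_. f)(3 := D, 4 := \<nu>)"
  \<comment> \<open>Variable \<open>0\<close> is \<open>\<alpha>\<close>, \<open>1\<close> the value
    \<open>p\<close>, \<open>2\<close> is \<open>f\<close>, \<open>3\<close> is \<open>D\<close>,
    \<open>4\<close> is \<open>\<nu>\<close>, \<open>5\<close> is \<open>X\<close>, \<open>6\<close>
    is \<open>Z\<close> and \<open>7\<close> a point. The value is the pair of
    \<open>\<alpha>\<close> and \<open>Z\<close> rather than \<open>Z\<close> itself, so that
    replacement produces a graph.\<close>
  let ?\<phi> = "FEx 5 (FEx 6 (FAnd (FAnd (maps_fm 2 5 0) (pair_fm 0 6 1)) (FAnd (FMem 6 4)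
     (FOr (FAll 7 (FIff (FMem 7 6) (FAnd (FMem 7 3) (FMem 7 5))))
          (FAll 7 (FIff (FMem 7 6) (FAnd (FMem 7 3) (FNot (FMem 7 5)))))))))"
  have e: "range ?e \<subseteq> M" using M by auto
  have S_iff: "Z \<^bold>\<in> \<nu> \<and> ((\<forall>w\<in>M. w \<^bold>\<in> Z \<longleftrightarrow> w \<^bold>\<in> D \<and> w \<^bold>\<in> X) \<or>
       (\<forall>w\<in>M. w \<^bold>\<in> Z \<longleftrightarrow> w \<^bold>\<in> D \<and> \<not> w \<^bold>\<in> X)) \<longleftrightarrow> S X Z"
    if "Z \<in> M" "X \<in> M" for X Z
    using memD[OF that(1)] memD[OF M(2)] unfolding S_def by blast
  have sat: "sat M ?\<phi> (?e(0 := \<alpha>, 1 := p)) \<longleftrightarrow> (\<exists>Z. T \<alpha> Z \<and> kpair \<alpha> Z p)"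
    if "\<alpha> \<in> M" "p \<in> M" for \<alpha> p
  proof -
    have "sat M ?\<phi> (?e(0 := \<alpha>, 1 := p)) \<longleftrightarrow>
      (\<exists>X\<in>M. \<exists>Z\<in>M. (maps_to M f X \<alpha> \<and> is_pair M \<alpha> Z p) \<and> S X Z)"
      by (simp add: sat_maps_fm sat_pair_fm S_iff cong: bex_cong)
    also have "\<dots> \<longleftrightarrow> (\<exists>X\<in>M. \<exists>Z\<in>M. (kmaps f X \<alpha> \<and> kpair \<alpha> Z p) \<and> S X Z)"
      using that M(1) by (simp add: maps_to_iff is_pair_iff)
    also have "\<dots> \<longleftrightarrow> (\<exists>Z. T \<alpha> Z \<and> kpair \<alpha> Z p)"
      using kmaps_memD M(1) kpair_memD that(2) unfolding T_def by blast
    finally show ?thesis .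
  qed
  have "\<exists>!p. p \<in> M \<and> sat M ?\<phi> (?e(0 := \<alpha>, 1 := p))" if \<alpha>\<beta>: "\<alpha> \<^bold>\<in> \<beta>" for \<alpha>
  proof -
    have \<alpha>: "\<alpha> \<in> M" using \<alpha>\<beta> M(4) memD by blast
    obtain Z where Z: "T \<alpha> Z" "\<And>Z'. T \<alpha> Z' \<Longrightarrow> Z' = Z" using T_unique[OF \<alpha>\<beta>] by blast
    have "Z \<in> M" using T_mem[OF Z(1)] M(3) memD by blast
    then obtain p where p: "p \<in> M" "kpair \<alpha> Z p" using kpair_exists \<alpha> by blast
    show ?thesis
    proof (rule ex1I[of _ p])
      show "p \<in> M \<and> sat M ?\<phi> (?e(0 := \<alpha>, 1 := p))"
        using p Z(1) sat[OF \<alpha> p(1)] by blast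
      fix q assume q: "q \<in> M \<and> sat M ?\<phi> (?e(0 := \<alpha>, 1 := q))"
      then have "kpair \<alpha> Z q" using sat[OF \<alpha>, of q] Z(2) by blast
      then show "q = p" using kpair_unique p q by blast
    qed
  qed
  then obtain g where g: "g \<in> M"
    "\<And>p. p \<^bold>\<in> g \<longleftrightarrow> p \<in> M \<and> (\<exists>\<alpha>. \<alpha> \<^bold>\<in> \<beta> \<and> sat M ?\<phi> (?e(0 := \<alpha>, 1 := p)))"
    using replacement[OF e M(4), of ?\<phi>] by blast
  have g': "p \<^bold>\<in> g \<longleftrightarrow> p \<in> M \<and> (\<exists>\<alpha> Z. \<alpha> \<^bold>\<in> \<beta> \<and> T \<alpha> Z \<and> kpair \<alpha> Z p)" for p
    using g(2)[of p] sat memD[OF M(4)] by blast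
  have maps: "kmaps g \<alpha> Z \<longleftrightarrow> T \<alpha> Z" if "\<alpha> \<^bold>\<in> \<beta>" for \<alpha> Z
  proof
    assume "kmaps g \<alpha> Z"
    then show "T \<alpha> Z" using kpair_inject g' unfolding kmaps_def by blast
  next
    assume T: "T \<alpha> Z"
    have "\<alpha> \<in> M" "Z \<in> M" using that T_mem[OF T] M memD by blast+
    then obtain p where "p \<in> M" "kpair \<alpha> Z p" using kpair_exists by blast
    then show "kmaps g \<alpha> Z" using g' T that unfolding kmaps_def by blast
  qed
  have "kfun g \<beta> \<nu>"
    unfolding kfun_def
  proof (intro conjI allI impI)
    show "\<exists>x y. x \<^bold>\<in> \<beta> \<and> y \<^bold>\<in> \<nu> \<and> kpair x y p" if "p \<^bold>\<in> g" for p
      using that g' T_mem by blast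
    show "\<exists>!y. kmaps g x y" if "x \<^bold>\<in> \<beta>" for x
      using T_unique[OF that] maps[OF that] by simp
  qed
  moreover have "\<exists>Z. kmaps g \<alpha> Z \<and> S X Z" if *: "\<alpha> \<^bold>\<in> \<beta>" "kmaps f X \<alpha>" for \<alpha> X
  proof -
    obtain Z where "S X Z" using side[OF *(2,1)] unfolding S_def by blast
    then show ?thesis using maps[OF that(1)] that(2) unfolding T_def by blast
  qed
  ultimately show ?thesis using that g(1) unfolding S_def by blast
qed

end

theorem theorem10:
  fixes V Vbar :: "'a::membership set" and \<delta> \<kappa> D \<nu> :: 'a
  assumes "transitive_class V" and "ZFC_model V"
    and "transitive_class Vbar" and "ZFC_model Vbar"
    and "V \<subseteq> Vbar"
    and "\<delta> \<in> Vbar" and "is_ordinal Vbar \<delta>"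
    and "\<kappa> \<in> Vbar" and "is_ordinal Vbar \<kappa>"
    and "\<delta> \<^bold>\<in> \<kappa> \<or> \<delta> = \<kappa>"
    and "approximation_property \<delta> V Vbar"
    and "D \<in> V" and "\<nu> \<in> Vbar"
    and "is_filter_on Vbar D \<nu>" and "is_complete_on Vbar \<kappa> D \<nu>"
    and "measures_subsets V D \<nu>"
  shows "\<exists>\<mu>\<in>V. (\<forall>x. x \<^bold>\<in> \<mu> \<longleftrightarrow> x \<^bold>\<in> \<nu> \<and> x \<in> V) \<and> is_measure_on V \<kappa> D \<mu>"
proof -
  interpret V: transitive_model V using assms by unfold_locales
  interpret W: transitive_model Vbar using assms by unfold_locales
  note VW = subsetD[OF assms(5)]
  have DW: "D \<in> Vbar" using VW assms(12) .

  \<comment> \<open>The hypotheses on \<open>\<nu>\<close> in unrelativized form\<close>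
  have \<nu>_sub: "w \<^bold>\<in> D" if "X \<^bold>\<in> \<nu>" "w \<^bold>\<in> X" for X w
    using assms(14) W.memD[OF assms(13) that(1)] W.memD that
    unfolding is_filter_on_def is_subset_def by blast
  have \<nu>_ne: "\<exists>w. w \<^bold>\<in> X" if "X \<^bold>\<in> \<nu>" for X
    using assms(14) W.memD[OF assms(13) that] that
    unfolding is_filter_on_def is_emptyset_def by blast
  have \<nu>_D: "D \<^bold>\<in> \<nu>" using assms(14) unfolding is_filter_on_def by blast
  have \<nu>_up: "Y \<^bold>\<in> \<nu>"
    if "X \<^bold>\<in> \<nu>" "Y \<in> Vbar" "\<And>w. w \<^bold>\<in> X \<Longrightarrow> w \<^bold>\<in> Y" "\<And>w. w \<^bold>\<in> Y \<Longrightarrow> w \<^bold>\<in> D" for X Y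
    using assms(14) W.memD[OF assms(13) that(1)] that
    unfolding is_filter_on_def is_subset_def by blast
  have \<nu>_inter: "\<exists>Z. Z \<^bold>\<in> \<nu> \<and> (\<forall>w. w \<^bold>\<in> Z \<longleftrightarrow> w \<^bold>\<in> X \<and> w \<^bold>\<in> Y)" if *: "X \<^bold>\<in> \<nu>" "Y \<^bold>\<in> \<nu>" for X Y
  proof -
    have XY: "X \<in> Vbar" "Y \<in> Vbar" using W.memD[OF assms(13)] that by blast+
    then obtain Z where Z: "Z \<in> Vbar" "is_inter Vbar X Y Z" "Z \<^bold>\<in> \<nu>"
      using assms(14) * unfolding is_filter_on_def by blast
    then have "\<forall>w. w \<^bold>\<in> Z \<longleftrightarrow> w \<^bold>\<in> X \<and> w \<^bold>\<in> Y"
      using W.memD[OF XY(1)] W.memD[OF Z(1)] unfolding is_inter_def by blast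
    then show ?thesis using Z(3) by blast
  qed
  have \<nu>_decides: "X \<^bold>\<in> \<nu> \<or> (\<exists>Y\<in>V. (\<forall>w. w \<^bold>\<in> Y \<longleftrightarrow> w \<^bold>\<in> D \<and> \<not> w \<^bold>\<in> X) \<and> Y \<^bold>\<in> \<nu>)"
    if "X \<in> V" "\<And>w. w \<^bold>\<in> X \<Longrightarrow> w \<^bold>\<in> D" for X
  proof -
    have "X \<^bold>\<in> \<nu> \<or> (\<exists>Y\<in>V. is_diff V D X Y \<and> Y \<^bold>\<in> \<nu>)"
      using assms(16) that unfolding measures_subsets_def is_subset_def by blast
    then show ?thesis
      using V.memD[OF assms(12)] V.memD unfolding is_diff_def by blast
  qed
  have \<nu>_complete: "\<exists>Y. Y \<^bold>\<in> \<nu> \<and>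
      (\<forall>x. x \<^bold>\<in> Y \<longleftrightarrow> x \<^bold>\<in> D \<and> (\<forall>\<alpha> X. \<alpha> \<^bold>\<in> \<beta> \<and> kmaps g \<alpha> X \<longrightarrow> x \<^bold>\<in> X))"
    if *: "\<beta> \<in> Vbar" "g \<in> Vbar" "\<beta> \<^bold>\<in> \<kappa>" "kfun g \<beta> \<nu>" for \<beta> g
  proof -
    have g_fun: "is_function Vbar g \<beta> \<nu>" using W.is_function_iff[OF *(2,1) assms(13)] *(4) by simp
    obtain Y where Y: "Y \<in> Vbar" "Y \<^bold>\<in> \<nu>" "\<forall>x\<in>Vbar. x \<^bold>\<in> Y \<longleftrightarrow>
        x \<^bold>\<in> D \<and> (\<forall>\<alpha>\<in>Vbar. \<forall>X\<in>Vbar. \<alpha> \<^bold>\<in> \<beta> \<and> maps_to Vbar g \<alpha> X \<longrightarrow> x \<^bold>\<in> X)"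
      using assms(15)[unfolded is_complete_on_def, THEN bspec, OF *(1), THEN bspec, OF *(2),
        THEN mp, OF conjI[OF *(3) g_fun]] by (elim bexE conjE) (rule that)
    have "(\<forall>\<alpha>\<in>Vbar. \<forall>X\<in>Vbar. \<alpha> \<^bold>\<in> \<beta> \<and> maps_to Vbar g \<alpha> X \<longrightarrow> x \<^bold>\<in> X) \<longleftrightarrow>
        (\<forall>\<alpha> X. \<alpha> \<^bold>\<in> \<beta> \<and> kmaps g \<alpha> X \<longrightarrow> x \<^bold>\<in> X)" for x
      using W.maps_to_iff[OF that(2)] W.kmaps_memD[OF _ that(2)] by blast
    with Y(3) have "\<forall>x\<in>Vbar. x \<^bold>\<in> Y \<longleftrightarrow>
        x \<^bold>\<in> D \<and> (\<forall>\<alpha> X. \<alpha> \<^bold>\<in> \<beta> \<and> kmaps g \<alpha> X \<longrightarrow> x \<^bold>\<in> X)" by (simp only:)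
    then have "\<forall>x. x \<^bold>\<in> Y \<longleftrightarrow> x \<^bold>\<in> D \<and> (\<forall>\<alpha> X. \<alpha> \<^bold>\<in> \<beta> \<and> kmaps g \<alpha> X \<longrightarrow> x \<^bold>\<in> X)"
      using W.memD[OF DW] W.memD[OF Y(1)] by blast
    then show ?thesis using Y(2) by blast
  qed

  \<comment> \<open>The trace of \<open>\<nu>\<close> on \<open>V\<close> and its
    approximations\<close>
  obtain P where P: "P \<in> V" "\<And>z. z \<^bold>\<in> P \<longleftrightarrow> z \<in> V \<and> (\<forall>w. w \<^bold>\<in> z \<longrightarrow> w \<^bold>\<in> D)"
    using V.power_set[OF assms(12)] by blast
  \<comment> \<open>The class \<open>V\<close> need not be definable in \<open>Vbar\<close>, so the
    set \<open>P\<close> replaces it: members of \<open>\<nu>\<close> are subsets of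
    \<open>D\<close>, hence those in \<open>V\<close> are exactly those in \<open>P\<close>.\<close>
  obtain \<mu> where "\<mu> \<in> Vbar" and "\<And>x. x \<^bold>\<in> \<mu> \<longleftrightarrow> x \<^bold>\<in> \<nu> \<and> x \<^bold>\<in> P"
    using W.inter_exists[OF assms(13) VW[OF P(1)]] by blast
  then have \<mu>W: "\<mu> \<in> Vbar" and \<mu>: "\<And>x. x \<^bold>\<in> \<mu> \<longleftrightarrow> x \<^bold>\<in> \<nu> \<and> x \<in> V"
    using P(2) \<nu>_sub by blast+

  have approx: "\<exists>b\<in>V. \<forall>x. x \<^bold>\<in> b \<longleftrightarrow> x \<^bold>\<in> \<mu> \<and> x \<^bold>\<in> a" if a: "a \<in> V" "size_less V a \<delta>" for a
  proof -
    obtain \<beta> f where \<beta>: "\<beta> \<in> V" "\<beta> \<^bold>\<in> \<delta>" and f: "f \<in> V" "is_bijection V f a \<beta>"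
      using a(2) unfolding size_less_def is_cardinality_def equinumerous_def by blast
    \<comment> \<open>Here \<open>\<delta> \<le> \<kappa>\<close> enters: \<open>\<beta>\<close>
      lies below \<open>\<delta>\<close>, and \<open>\<kappa>\<close> is transitive.\<close>
    have \<beta>\<kappa>: "\<beta> \<^bold>\<in> \<kappa>"
      using assms(6,9,10) \<beta>(2) VW[OF \<beta>(1)] unfolding is_ordinal_def is_subset_def by blast
    have f_fun: "kfun f a \<beta>"
      using f(2) V.is_function_iff[OF f(1) a(1) \<beta>(1)] unfolding is_bijection_def by simp
    have pre: "\<exists>!X. kmaps f X \<alpha>" if "\<alpha> \<^bold>\<in> \<beta>" for \<alpha>
    proof -
      have "\<alpha> \<in> V" using V.memD \<beta>(1) that by blast
      then have "\<exists>!X. X \<in> V \<and> maps_to V f X \<alpha>"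
        using f(2) that unfolding is_bijection_def by blast
      then show ?thesis
        using V.maps_to_iff[OF f(1) _ \<open>\<alpha> \<in> V\<close>] V.kmaps_memD[OF _ f(1)] by metis
    qed
    have side: "\<exists>!Z. Z \<^bold>\<in> \<nu> \<and>
       ((\<forall>w. w \<^bold>\<in> Z \<longleftrightarrow> w \<^bold>\<in> D \<and> w \<^bold>\<in> X) \<or> (\<forall>w. w \<^bold>\<in> Z \<longleftrightarrow> w \<^bold>\<in> D \<and> \<not> w \<^bold>\<in> X))"
      if X: "X \<in> V" for X
    proof -
      define Q where "Q Z \<longleftrightarrow> (\<forall>w. w \<^bold>\<in> Z \<longleftrightarrow> w \<^bold>\<in> D \<and> w \<^bold>\<in> X)" for Z
      define R where "R Z \<longleftrightarrow> (\<forall>w. w \<^bold>\<in> Z \<longleftrightarrow> w \<^bold>\<in> D \<and> \<not> w \<^bold>\<in> X)" for Z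
      \<comment> \<open>Elements of \<open>a\<close> need not be subsets of \<open>D\<close>, so the
        decision is made for the trace of \<open>X\<close> on \<open>D\<close>.\<close>
      obtain X' where X': "X' \<in> V" "\<And>w. w \<^bold>\<in> X' \<longleftrightarrow> w \<^bold>\<in> D \<and> w \<^bold>\<in> X"
        using V.inter_exists[OF assms(12) X] by blast
      have "\<exists>Z. Z \<^bold>\<in> \<nu> \<and> (Q Z \<or> R Z)"
        using \<nu>_decides[OF X'(1)] X'(2) unfolding Q_def R_def by auto
      moreover have "Z = Z'"
        if *: "Z \<^bold>\<in> \<nu>" "Z' \<^bold>\<in> \<nu>" "Q Z \<or> R Z" "Q Z' \<or> R Z'" for Z Z'
      proof -
        \<comment> \<open>Two members of a filter meet, whereas opposite sides are disjoint; so both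
          are the same side.\<close>
        obtain w where "w \<^bold>\<in> Z" "w \<^bold>\<in> Z'" using \<nu>_inter[OF *(1,2)] \<nu>_ne by blast
        then have "(Q Z \<and> Q Z') \<or> (R Z \<and> R Z')"
          using that(3,4) unfolding Q_def R_def by blast
        then show ?thesis
          using W.extensionality[OF W.memD[OF assms(13) that(1)] W.memD[OF assms(13) that(2)]]
          unfolding Q_def R_def by blast
      qed
      ultimately show ?thesis unfolding Q_def[symmetric] R_def[symmetric] by blast
    qed
    \<comment> \<open>The sequence is formed in \<open>Vbar\<close> because its definition refers to
      \<open>\<nu>\<close>, which need not belong to \<open>V\<close>.\<close>
    obtain g where g: "g \<in> Vbar" "kfun g \<beta> \<nu>"
      "\<And>\<alpha> X. \<alpha> \<^bold>\<in> \<beta> \<Longrightarrow> kmaps f X \<alpha> \<Longrightarrow> \<exists>Z. kmaps g \<alpha> Z \<and> Z \<^bold>\<in> \<nu> \<and>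
       ((\<forall>w. w \<^bold>\<in> Z \<longleftrightarrow> w \<^bold>\<in> D \<and> w \<^bold>\<in> X) \<or> (\<forall>w. w \<^bold>\<in> Z \<longleftrightarrow> w \<^bold>\<in> D \<and> \<not> w \<^bold>\<in> X))"
    proof (rule W.choice_of_sides[OF VW[OF f(1)] DW assms(13) VW[OF \<beta>(1)] pre])
      show "\<exists>!Z. Z \<^bold>\<in> \<nu> \<and>
         ((\<forall>w. w \<^bold>\<in> Z \<longleftrightarrow> w \<^bold>\<in> D \<and> w \<^bold>\<in> X) \<or> (\<forall>w. w \<^bold>\<in> Z \<longleftrightarrow> w \<^bold>\<in> D \<and> \<not> w \<^bold>\<in> X))"
        if "kmaps f X \<alpha>" for X \<alpha>
        using side V.kmaps_memD[OF that f(1)] by blast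
    qed blast+
    obtain Y where Y: "Y \<^bold>\<in> \<nu>"
      "\<forall>x. x \<^bold>\<in> Y \<longleftrightarrow> x \<^bold>\<in> D \<and> (\<forall>\<alpha> X. \<alpha> \<^bold>\<in> \<beta> \<and> kmaps g \<alpha> X \<longrightarrow> x \<^bold>\<in> X)"
      using \<nu>_complete[OF VW[OF \<beta>(1)] g(1) \<beta>\<kappa> g(2)] by blast
    \<comment> \<open>The point \<open>d\<close> lies in all chosen sides at once. It belongs to
      \<open>D\<close> and hence to \<open>V\<close>, so it can serve as a parameter there.\<close>
    obtain d where d: "d \<^bold>\<in> Y" using \<nu>_ne[OF Y(1)] by blast
    have "d \<in> V" using d Y(2) V.memD[OF assms(12)] by blast
    have key: "X \<^bold>\<in> \<nu> \<longleftrightarrow> d \<^bold>\<in> X" if X: "X \<^bold>\<in> a" "X \<^bold>\<in> P" for X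
    proof -
      have XV: "X \<in> V" and XD: "\<And>w. w \<^bold>\<in> X \<Longrightarrow> w \<^bold>\<in> D" using X(2) P(2) by blast+
      obtain \<alpha> where \<alpha>: "kmaps f X \<alpha>" using f_fun X(1) unfolding kfun_def by blast
      then have "\<alpha> \<^bold>\<in> \<beta>" using kfun_range f_fun by blast
      then obtain Z where Z: "kmaps g \<alpha> Z" "Z \<^bold>\<in> \<nu>"
        "(\<forall>w. w \<^bold>\<in> Z \<longleftrightarrow> w \<^bold>\<in> D \<and> w \<^bold>\<in> X) \<or> (\<forall>w. w \<^bold>\<in> Z \<longleftrightarrow> w \<^bold>\<in> D \<and> \<not> w \<^bold>\<in> X)"
        using g(3) \<alpha> by blast
      have dZ: "d \<^bold>\<in> Z" using d Y(2) Z(1) \<open>\<alpha> \<^bold>\<in> \<beta>\<close> by blast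
      show ?thesis
      proof
        assume "X \<^bold>\<in> \<nu>"
        \<comment> \<open>\<open>X\<close> meets its chosen side \<open>Z\<close>, so
          \<open>Z\<close> cannot be the complement and must be the trace of
          \<open>X\<close>.\<close>
        then obtain w where "w \<^bold>\<in> X" "w \<^bold>\<in> Z" using \<nu>_inter[OF _ Z(2)] \<nu>_ne by blast
        then show "d \<^bold>\<in> X" using Z(3) dZ by blast
      next
        assume "d \<^bold>\<in> X"
        \<comment> \<open>The common point \<open>d\<close> excludes the complement, so
          \<open>Z\<close> is contained in \<open>X\<close> and upward closure applies.\<close>
        then have "\<And>w. w \<^bold>\<in> Z \<Longrightarrow> w \<^bold>\<in> X" using Z(3) dZ by blast
        then show "X \<^bold>\<in> \<nu>" using \<nu>_up[OF Z(2) VW[OF XV]] XD by blast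
      qed
    qed
    obtain c where c: "c \<in> V" "\<And>x. x \<^bold>\<in> c \<longleftrightarrow> x \<^bold>\<in> a \<and> x \<^bold>\<in> P"
      using V.inter_exists[OF a(1) P(1)] by blast
    have "range (\<lambda>_::nat. d) \<subseteq> V" using \<open>d \<in> V\<close> by auto
    \<comment> \<open>Variable \<open>1\<close> denotes \<open>d\<close>, so \<open>b\<close>
      collects the subsets of \<open>D\<close> in \<open>a\<close> that contain \<open>d\<close>.
      Only parameters from \<open>V\<close> occur, and by \<open>key\<close> this is the required
      approximation.\<close>
    then obtain b where b: "b \<in> V" "\<And>x. x \<^bold>\<in> b \<longleftrightarrow> x \<^bold>\<in> c \<and> sat V (FMem 1 0) ((\<lambda>_. d)(0 := x))"
      using V.separation c(1) by blast
    have "x \<^bold>\<in> b \<longleftrightarrow> x \<^bold>\<in> \<mu> \<and> x \<^bold>\<in> a" for x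
    proof -
      have "x \<^bold>\<in> b \<longleftrightarrow> x \<^bold>\<in> a \<and> x \<^bold>\<in> P \<and> d \<^bold>\<in> x" using b(2)[of x] c(2) by simp
      also have "\<dots> \<longleftrightarrow> x \<^bold>\<in> \<mu> \<and> x \<^bold>\<in> a" using key[of x] \<mu>[of x] P(2)[of x] \<nu>_sub by blast
      finally show ?thesis .
    qed
    then show ?thesis using b(1) by blast
  qed
  have \<mu>V: "\<mu> \<in> V"
    using assms(11) \<mu>W \<mu> approx unfolding approximation_property_def by blast

  \<comment> \<open>The trace is a measure in \<open>V\<close>\<close>
  have "is_filter_on V D \<mu>"
    unfolding is_filter_on_def
  proof (intro conjI ballI impI)
    fix X assume X: "X \<in> V" "X \<^bold>\<in> \<mu>"
    then have "X \<^bold>\<in> \<nu>" using \<mu> by blast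
    then show "is_subset V X D" "\<not> is_emptyset V X"
      using \<nu>_sub \<nu>_ne V.memD[OF X(1)] unfolding is_subset_def is_emptyset_def by blast+
  next
    show "D \<^bold>\<in> \<mu>" using \<mu> \<nu>_D assms(12) by blast
  next
    fix X Y assume XY: "X \<in> V" "Y \<in> V" "X \<^bold>\<in> \<mu> \<and> is_subset V X Y \<and> is_subset V Y D"
    then have "\<And>w. w \<^bold>\<in> X \<Longrightarrow> w \<^bold>\<in> Y" "\<And>w. w \<^bold>\<in> Y \<Longrightarrow> w \<^bold>\<in> D"
      using V.memD unfolding is_subset_def by blast+
    then show "Y \<^bold>\<in> \<mu>" using \<nu>_up[of X Y] XY VW \<mu> by blast
  next
    fix X Y assume XY: "X \<in> V" "Y \<in> V" "X \<^bold>\<in> \<mu> \<and> Y \<^bold>\<in> \<mu>"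
    obtain Z where Z: "Z \<^bold>\<in> \<nu>" "\<forall>w. w \<^bold>\<in> Z \<longleftrightarrow> w \<^bold>\<in> X \<and> w \<^bold>\<in> Y"
      using \<nu>_inter XY(3) \<mu> by blast
    obtain Z' where Z': "Z' \<in> V" "\<And>w. w \<^bold>\<in> Z' \<longleftrightarrow> w \<^bold>\<in> X \<and> w \<^bold>\<in> Y"
      using V.inter_exists XY by blast
    \<comment> \<open>The intersection formed in \<open>V\<close> is the one already known to be in
      \<open>\<nu>\<close>; lying in both \<open>\<nu>\<close> and \<open>V\<close>, it belongs to
      \<open>\<mu>\<close>.\<close>
    have "Z' = Z" using W.extensionality VW[OF Z'(1)] W.memD[OF assms(13) Z(1)] Z(2) Z'(2) by blast
    then show "\<exists>Z\<in>V. is_inter V X Y Z \<and> Z \<^bold>\<in> \<mu>"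
      using Z Z' \<mu> unfolding is_inter_def by blast
  qed
  moreover have "is_complete_on V \<kappa> D \<mu>"
    unfolding is_complete_on_def
  proof (intro ballI impI)
    fix \<beta> g assume g: "\<beta> \<in> V" "g \<in> V" "\<beta> \<^bold>\<in> \<kappa> \<and> is_function V g \<beta> \<mu>"
    then have "kfun g \<beta> \<mu>" using V.is_function_iff[OF g(2,1) \<mu>V] by simp
    \<comment> \<open>A sequence in \<open>V\<close> of members of \<open>\<mu>\<close> is, seen in
      \<open>Vbar\<close>, a sequence of members of \<open>\<nu>\<close>, so completeness there
      applies.\<close>
    then have "kfun g \<beta> \<nu>" using kfun_codomain_mono \<mu> by blast
    then obtain Y where Y: "Y \<^bold>\<in> \<nu>"
      "\<forall>x. x \<^bold>\<in> Y \<longleftrightarrow> x \<^bold>\<in> D \<and> (\<forall>\<alpha> X. \<alpha> \<^bold>\<in> \<beta> \<and> kmaps g \<alpha> X \<longrightarrow> x \<^bold>\<in> X)"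
      using \<nu>_complete VW g by blast
    obtain Y' where Y': "Y' \<in> V"
      "\<And>x. x \<^bold>\<in> Y' \<longleftrightarrow> x \<^bold>\<in> D \<and> (\<forall>\<alpha> X. \<alpha> \<^bold>\<in> \<beta> \<and> kmaps g \<alpha> X \<longrightarrow> x \<^bold>\<in> X)"
      using V.sequence_intersection_exists[OF assms(12) g(2,1)] by blast
    \<comment> \<open>Extensionality in \<open>Vbar\<close> identifies the intersection from
      completeness with the one separated in \<open>V\<close>, which is thereby in
      \<open>\<mu>\<close>.\<close>
    have Y'Y: "Y' = Y"
      using W.extensionality[OF VW[OF Y'(1)] W.memD[OF assms(13) Y(1)]] Y(2) Y'(2) by blast
    have "(\<forall>\<alpha>\<in>V. \<forall>X\<in>V. \<alpha> \<^bold>\<in> \<beta> \<and> maps_to V g \<alpha> X \<longrightarrow> x \<^bold>\<in> X) \<longleftrightarrow>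
        (\<forall>\<alpha> X. \<alpha> \<^bold>\<in> \<beta> \<and> kmaps g \<alpha> X \<longrightarrow> x \<^bold>\<in> X)" for x
      using V.maps_to_iff[OF g(2)] V.kmaps_memD[OF _ g(2)] by blast
    then have "\<forall>x\<in>V. x \<^bold>\<in> Y' \<longleftrightarrow>
        x \<^bold>\<in> D \<and> (\<forall>\<alpha>\<in>V. \<forall>X\<in>V. \<alpha> \<^bold>\<in> \<beta> \<and> maps_to V g \<alpha> X \<longrightarrow> x \<^bold>\<in> X)"
      by (simp add: Y'(2))
    then show "\<exists>Y\<in>V. Y \<^bold>\<in> \<mu> \<and> (\<forall>x\<in>V. x \<^bold>\<in> Y \<longleftrightarrow>
        x \<^bold>\<in> D \<and> (\<forall>\<alpha>\<in>V. \<forall>X\<in>V. \<alpha> \<^bold>\<in> \<beta> \<and> maps_to V g \<alpha> X \<longrightarrow> x \<^bold>\<in> X))"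
      using Y(1) Y'(1) Y'Y \<mu> by (intro bexI[of _ Y'] conjI) auto
  qed
  moreover have "measures_subsets V D \<mu>"
    \<comment> \<open>Both the set and its complement provided by the hypothesis are in
      \<open>V\<close>, so membership in \<open>\<nu>\<close> becomes membership in
      \<open>\<mu>\<close>.\<close>
    using assms(16) \<mu> unfolding measures_subsets_def by blast
  ultimately show ?thesis using \<mu>V \<mu> unfolding is_measure_on_def by blast
qed

end
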